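(* Let $G$ be a graph without isolated vertices whose vertex cover number equals $k$. Then either $G$ is not well covered, or $G$ has at most $5k$ vertices.
   Context: The vertex cover number of $G$ is the size of a minimum vertex cover. A graph is well covered if all its minimal vertex covers have the same size (equivalently, all maximal independent sets have the same size). *)

theory Defs
  imports "Graph_Theory.Digraph"
begin

(* Finite simple graphs are represented by the locale predicate graph of the
   imported theory: finite, loop-free symmetric digraphs without parallel arcs,
   so each undirected edge {u, v} is the pair of arcs (u, v), (v, u). *)

definition isolated_vertex :: "('a, 'b) pre_digraph \<Rightarrow> 'a \<Rightarrow> bool" where
  "isolated_vertex G v \<longleftrightarrow> v \<in> verts G \<and> \<not> (\<exists>w \<in> verts G. v \<rightarrow>\<^bsub>G\<^esub> w)"

definition vertex_cover :: "('a, 'b) pre_digraph \<Rightarrow> 'a set \<Rightarrow> bool" where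
  "vertex_cover G C \<longleftrightarrow>
     C \<subseteq> verts G \<and> (\<forall>u v. u \<rightarrow>\<^bsub>G\<^esub> v \<longrightarrow> u \<in> C \<or> v \<in> C)"

(* Minimal with respect to inclusion, as opposed to minimum. *)
definition minimal_vertex_cover :: "('a, 'b) pre_digraph \<Rightarrow> 'a set \<Rightarrow> bool" where
  "minimal_vertex_cover G C \<longleftrightarrow>
     vertex_cover G C \<and> \<not> (\<exists>D. D \<subset> C \<and> vertex_cover G D)"

definition vertex_cover_number :: "('a, 'b) pre_digraph \<Rightarrow> nat" where
  "vertex_cover_number G = Min (card ` {C. vertex_cover G C})"

definition well_covered :: "('a, 'b) pre_digraph \<Rightarrow> bool" where
  "well_covered G \<longleftrightarrow>
     (\<forall>C D. minimal_vertex_cover G C \<longrightarrow> minimal_vertex_cover G D \<longrightarrow> card C = card D)"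

end

theory Submission
  imports Defs
begin

text \<open>
  Let \<open>C\<close> be a minimum vertex cover and \<open>I\<close> its complement, which is independent. If \<open>S\<close> is a
  maximal independent subset of \<open>C\<close>, exchanging \<open>S\<close> for its neighbours in \<open>I\<close> yields a minimal
  cover, so well-coveredness forces \<open>S\<close> to have exactly \<open>card S\<close> neighbours in \<open>I\<close>; any
  independent \<open>T \<subseteq> C\<close> has at least \<open>card T\<close> of them, since the exchange gives a cover. Hence
  at most \<open>card (S - T)\<close> vertices of \<open>I\<close> see \<open>S\<close> but not \<open>T\<close> when \<open>T \<subseteq> S\<close>. Peeling maximal
  independent sets off \<open>C\<close> one after the other then exhausts \<open>I\<close>, because no vertex is isolated,
  and gives \<open>card I \<le> card C\<close>. So even \<open>2 * k\<close> is a valid bound.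
\<close>

definition independent_verts :: "('a, 'b) pre_digraph \<Rightarrow> 'a set \<Rightarrow> bool" where
  "independent_verts G S \<longleftrightarrow> (\<forall>u\<in>S. \<forall>v\<in>S. \<not> u \<rightarrow>\<^bsub>G\<^esub> v)"

definition outer_nbrs :: "('a, 'b) pre_digraph \<Rightarrow> 'a set \<Rightarrow> 'a set \<Rightarrow> 'a set" where
  "outer_nbrs G C S = {v \<in> verts G - C. \<exists>u\<in>S. u \<rightarrow>\<^bsub>G\<^esub> v}"

lemma independent_verts_subset: "independent_verts G S \<Longrightarrow> T \<subseteq> S \<Longrightarrow> independent_verts G T"
  unfolding independent_verts_def by blast

lemma outer_nbrs_Un: "outer_nbrs G C (S \<union> T) = outer_nbrs G C S \<union> outer_nbrs G C T"
  unfolding outer_nbrs_def by blast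

lemma outer_nbrs_mono: "S \<subseteq> T \<Longrightarrow> outer_nbrs G C S \<subseteq> outer_nbrs G C T"
  unfolding outer_nbrs_def by blast

context graph
begin

lemma adj_sym: "u \<rightarrow>\<^bsub>G\<^esub> v \<Longrightarrow> v \<rightarrow>\<^bsub>G\<^esub> u"
  using sym_arcs unfolding symmetric_def by (rule symD)

lemma finite_outer_nbrs: "finite (outer_nbrs G C S)"
  unfolding outer_nbrs_def by simp

lemma finite_vertex_cover: "vertex_cover G C \<Longrightarrow> finite C"
  unfolding vertex_cover_def by (meson finite_subset finite_verts)

lemma extend_to_maximal_independent:
  assumes "finite W" "A \<subseteq> W" "independent_verts G A"
  obtains S where "A \<subseteq> S" "S \<subseteq> W" "independent_verts G S"
    "\<forall>x\<in>W - S. \<exists>y\<in>S. y \<rightarrow>\<^bsub>G\<^esub> x"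
proof -
  let ?F = "{S. S \<subseteq> W \<and> independent_verts G S}"
  have "finite ?F" "A \<in> ?F" using assms by auto
  then obtain S where S: "S \<in> ?F" "A \<subseteq> S" "\<forall>B\<in>?F. S \<subseteq> B \<longrightarrow> S = B"
    using finite_has_maximal2[of ?F A] by auto
  have "\<exists>y\<in>S. y \<rightarrow>\<^bsub>G\<^esub> x" if x: "x \<in> W - S" for x
  proof (rule ccontr)
    assume no: "\<not> ?thesis"
    have "independent_verts G (insert x S)"
      using S(1) no adj_sym adj_not_same unfolding independent_verts_def by blast
    then have "insert x S \<in> ?F" using S(1) x by blast
    then show False using S(3) x by blast
  qed
  with S show thesis by (intro that[of S]) auto
qed

text \<open>An edge that loses an endpoint in \<open>S\<close> has its other endpoint outside
  \<open>S\<close> by independence: either in \<open>C - S\<close>, or outside \<open>C\<close> and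
  then an outer neighbour of \<open>S\<close>.\<close>

lemma exchange_vertex_cover:
  assumes C: "vertex_cover G C" and S: "S \<subseteq> C" "independent_verts G S"
  shows "vertex_cover G (C - S \<union> outer_nbrs G C S)"
  unfolding vertex_cover_def
proof (intro conjI allI impI)
  show "C - S \<union> outer_nbrs G C S \<subseteq> verts G"
    using C unfolding vertex_cover_def outer_nbrs_def by blast
next
  fix u v assume e: "u \<rightarrow>\<^bsub>G\<^esub> v"
  have "u \<in> verts G" "v \<in> verts G" "v \<rightarrow>\<^bsub>G\<^esub> u" "u \<in> C \<or> v \<in> C"
    using e C adj_in_verts adj_sym unfolding vertex_cover_def by blast+
  then show "u \<in> C - S \<union> outer_nbrs G C S \<or> v \<in> C - S \<union> outer_nbrs G C S"
    using e S unfolding outer_nbrs_def independent_verts_def by blast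
qed

text \<open>Each vertex of the new cover has a neighbour in \<open>S\<close>, by maximality or by
  being an outer neighbour. That neighbour lies outside the cover, so dropping the vertex uncovers
  an edge.\<close>

lemma exchange_minimal_vertex_cover:
  assumes C: "vertex_cover G C" and S: "S \<subseteq> C" "independent_verts G S"
    and max: "\<forall>x\<in>C - S. \<exists>y\<in>S. y \<rightarrow>\<^bsub>G\<^esub> x"
  shows "minimal_vertex_cover G (C - S \<union> outer_nbrs G C S)"
  unfolding minimal_vertex_cover_def
proof (intro conjI notI)
  show "vertex_cover G (C - S \<union> outer_nbrs G C S)"
    by (rule exchange_vertex_cover[OF C S])
next
  assume "\<exists>D. D \<subset> C - S \<union> outer_nbrs G C S \<and> vertex_cover G D"
  then obtain D x where D: "D \<subseteq> C - S \<union> outer_nbrs G C S" "vertex_cover G D"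
    and x: "x \<in> C - S \<union> outer_nbrs G C S" "x \<notin> D" by blast
  obtain y where y: "y \<in> S" "y \<rightarrow>\<^bsub>G\<^esub> x"
    using x(1) max unfolding outer_nbrs_def by blast
  have "y \<notin> D" using D(1) y(1) S(1) unfolding outer_nbrs_def by blast
  then show False using D(2) y(2) x(2) unfolding vertex_cover_def by blast
qed

lemma card_exchange:
  assumes "vertex_cover G C" "S \<subseteq> C"
  shows "card (C - S \<union> outer_nbrs G C S) + card S = card C + card (outer_nbrs G C S)"
proof -
  have fin: "finite C" by (rule finite_vertex_cover[OF assms(1)])
  have "card (C - S \<union> outer_nbrs G C S) = card (C - S) + card (outer_nbrs G C S)"
    using fin by (intro card_Un_disjoint finite_outer_nbrs) (auto simp: outer_nbrs_def)
  moreover have "card (C - S) + card S = card C"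
    using card_Un_disjoint[of "C - S" S] fin assms(2)
    by (metis Diff_disjoint Diff_partition Un_commute finite_Diff finite_subset inf_commute)
  ultimately show ?thesis by simp
qed

lemma card_complement_le_minimum_cover:
  assumes wc: "well_covered G" and noiso: "\<not> (\<exists>v. isolated_vertex G v)"
    and C: "vertex_cover G C" and min: "\<And>D. vertex_cover G D \<Longrightarrow> card C \<le> card D"
  shows "card (verts G - C) \<le> card C"
proof -
  note fin = finite_vertex_cover[OF C]
  have minC: "minimal_vertex_cover G C"
    unfolding minimal_vertex_cover_def
    using C min psubset_card_mono[OF fin] by (meson leD)
  have lower: "card T \<le> card (outer_nbrs G C T)" if "T \<subseteq> C" "independent_verts G T" for T
    using min[OF exchange_vertex_cover[OF C that]] card_exchange[OF C that(1)] by simp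
  \<comment> \<open>Invariant of the peeling: \<open>W\<close> is the part of \<open>C\<close> not
    yet peeled off, and the outside vertices not seen from \<open>C - W\<close> are counted. The
    case \<open>W = C\<close> is the claim.\<close>
  have unseen: "card (verts G - C - outer_nbrs G C (C - W)) \<le> card W" if "W \<subseteq> C" for W
    using finite_subset[OF that fin] that
  proof (induction W rule: finite_psubset_induct)
    case (psubset W)
    show ?case
    proof (cases "W = {}")
      case True
      have "\<exists>u\<in>C. u \<rightarrow>\<^bsub>G\<^esub> v" if "v \<in> verts G - C" for v
        using that noiso C adj_sym unfolding isolated_vertex_def vertex_cover_def by blast
      then have "verts G - C - outer_nbrs G C C = {}" unfolding outer_nbrs_def by blast
      with True show ?thesis by simp
    next
      case False
      have empty: "independent_verts G {}" unfolding independent_verts_def by simp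
      obtain S where S: "S \<subseteq> W" "independent_verts G S"
          "\<forall>x\<in>W - S. \<exists>y\<in>S. y \<rightarrow>\<^bsub>G\<^esub> x"
        using extend_to_maximal_independent[OF psubset.hyps empty_subsetI empty] by metis
      have "S \<noteq> {}" using S(3) False by blast
      have "S \<subseteq> C" using S(1) psubset.prems by blast
      \<comment> \<open>\<open>S\<close> is maximal only within \<open>W\<close>, while
        well-coveredness yields an exact neighbour count only for sets maximal within
        \<open>C\<close>; hence the extension to \<open>M\<close>.\<close>
      obtain M where M: "S \<subseteq> M" "M \<subseteq> C" "independent_verts G M"
          "\<forall>x\<in>C - M. \<exists>y\<in>M. y \<rightarrow>\<^bsub>G\<^esub> x"
        by (rule extend_to_maximal_independent[OF fin \<open>S \<subseteq> C\<close> S(2)])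
      define T where "T = M - S"
      have MT: "M = S \<union> T" "S \<inter> T = {}" "T \<subseteq> M" using M(1) by (auto simp: T_def)
      \<comment> \<open>A vertex of \<open>T\<close> in \<open>W\<close> would lie in
        \<open>W - S\<close> and so be adjacent to \<open>S\<close>, against the independence of
        \<open>M\<close>. Thus everything \<open>T\<close> sees is already seen from
        \<open>C - W\<close>.\<close>
      have "T \<subseteq> C - W"
        using S(3) M(1-3) unfolding T_def independent_verts_def by blast
      have "card (outer_nbrs G C M) = card M"
        using wc minC exchange_minimal_vertex_cover[OF C M(2-4)] card_exchange[OF C M(2)]
        unfolding well_covered_def by (metis add_left_cancel)
      moreover have "card T \<le> card (outer_nbrs G C T)"
        using lower MT(3) M(2,3) independent_verts_subset by (meson order_trans)
      moreover have "card M = card S + card T"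
        unfolding MT(1) using MT M(2) fin by (intro card_Un_disjoint) (auto intro: finite_subset)
      moreover have "card (outer_nbrs G C M - outer_nbrs G C T)
          = card (outer_nbrs G C M) - card (outer_nbrs G C T)"
        by (rule card_Diff_subset[OF finite_outer_nbrs outer_nbrs_mono[OF MT(3)]])
      ultimately have fresh: "card (outer_nbrs G C M - outer_nbrs G C T) \<le> card S" by simp
      have "W - S \<subset> W" using S(1) \<open>S \<noteq> {}\<close> by blast
      then have IH: "card (verts G - C - outer_nbrs G C (C - (W - S))) \<le> card (W - S)"
        using psubset.IH psubset.prems by blast
      have "C - (W - S) = (C - W) \<union> S" using \<open>S \<subseteq> C\<close> S(1) by blast
      \<comment> \<open>A vertex unseen from \<open>C - W\<close> either is seen by
        \<open>S\<close>, hence by \<open>M\<close> but not by \<open>T\<close>, or stays unseen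
        once \<open>S\<close> is peeled off too.\<close>
      then have "verts G - C - outer_nbrs G C (C - W)
          \<subseteq> (outer_nbrs G C M - outer_nbrs G C T)
            \<union> (verts G - C - outer_nbrs G C (C - (W - S)))"
        using outer_nbrs_mono[OF \<open>T \<subseteq> C - W\<close>, of G C] outer_nbrs_mono[OF M(1), of G C]
        by (auto simp: outer_nbrs_Un)
      then have "card (verts G - C - outer_nbrs G C (C - W))
          \<le> card (outer_nbrs G C M - outer_nbrs G C T)
            + card (verts G - C - outer_nbrs G C (C - (W - S)))"
        by (meson card_Un_le card_mono finite_Diff finite_UnI finite_outer_nbrs finite_verts
            order_trans)
      also have "\<dots> \<le> card S + card (W - S)" using fresh IH by simp
      also have "\<dots> = card W"
        using S(1) psubset.hyps card_mono[of W S] by (simp add: card_Diff_subset finite_subset)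
      finally show ?thesis .
    qed
  qed
  have "outer_nbrs G C {} = {}" unfolding outer_nbrs_def by simp
  then show ?thesis using unseen[of C] by simp
qed

lemma minimum_vertex_cover_exists:
  obtains C where "vertex_cover G C" "card C = vertex_cover_number G"
    "\<And>D. vertex_cover G D \<Longrightarrow> card C \<le> card D"
proof -
  have fin: "finite (card ` {C. vertex_cover G C})"
    by (rule finite_imageI, rule finite_subset[of _ "Pow (verts G)"])
      (auto simp: vertex_cover_def)
  \<comment> \<open>Some cover exists, so \<open>Min\<close> is taken over a nonempty set and is
    attained.\<close>
  have "vertex_cover G (verts G)"
    unfolding vertex_cover_def using adj_in_verts by blast
  then have "vertex_cover_number G \<in> card ` {C. vertex_cover G C}"
    unfolding vertex_cover_number_def using fin by (intro Min_in) auto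
  then obtain C where C: "vertex_cover G C" "card C = vertex_cover_number G" by auto
  moreover have "card C \<le> card D" if "vertex_cover G D" for D
    unfolding C(2) vertex_cover_number_def using fin that by (intro Min_le) auto
  ultimately show thesis using that by blast
qed

end

theorem theorem8:
  fixes G :: "('a, 'b) pre_digraph" and k :: nat
  assumes "graph G"
    and "\<not> (\<exists>v. isolated_vertex G v)"
    and "vertex_cover_number G = k"
  shows "\<not> well_covered G \<or> card (verts G) \<le> 5 * k"
proof -
  interpret graph G by fact
  obtain C where C: "vertex_cover G C" "card C = k"
      "\<And>D. vertex_cover G D \<Longrightarrow> card C \<le> card D"
    using minimum_vertex_cover_exists assms(3) by metis
  have "card (verts G) \<le> 5 * k" if "well_covered G"
  proof -
    have "card (verts G - C) \<le> k"
      using card_complement_le_minimum_cover[OF that assms(2) C(1,3)] C(2) by simp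
    moreover have "card (verts G - C) = card (verts G) - k"
      using C(1,2) finite_vertex_cover by (simp add: card_Diff_subset vertex_cover_def)
    ultimately show ?thesis by simp
  qed
  then show ?thesis by blast
qed

end
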